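(* Let $k\ge 1$, $\alpha\in\mathbb{C}$ and $-\beta,\gamma\in\mathbb{C}\setminus\mathbb{Z}_{\leq 0}$. Let $\mathbf{u},\mathbf{x}\in\mathbb{C}^k$ with $|u_1|+\cdots+|u_k|<1$. Then $$\Phi_1\left[\alpha,\beta;\gamma;-\langle \mathbf{u}\rangle,-\langle \mathbf{u}\circ \mathbf{x}\rangle\right]=\sum_{\mathbf{n}=\mathbf{0}}^{\infty}\frac{(\alpha)_{\langle \mathbf{n}\rangle}}{(\gamma)_{\langle \mathbf{n}\rangle}}L_{\mathbf{n}}^{(-\beta-\langle \mathbf{n}\rangle)}(\mathbf{x})\,\mathbf{u}^{\mathbf{n}}.$$ In particular, when $\alpha=\gamma$, $$\mathrm{e}^{-\langle\mathbf{u}\circ \mathbf{x}\rangle}(1+\langle\mathbf{u}\rangle)^{-\beta}=\sum_{\mathbf{n}=\mathbf{0}}^{\infty}L_{\mathbf{n}}^{(-\beta-\langle \mathbf{n}\rangle)}(\mathbf{x})\,\mathbf{u}^{\mathbf{n}}.$$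
   Context: Boldface letters denote vectors of dimension $k$. For $\mathbf{x},\mathbf{y}\in\mathbb{C}^k$ and $\mathbf{n}\in\mathbb{Z}_{\geq0}^k$: $\langle\mathbf{x}\rangle:=x_1+\cdots+x_k$, $\mathbf{x}\circ\mathbf{y}:=(x_1y_1,\ldots,x_ky_k)$, $\mathbf{x}^{\mathbf{n}}:=x_1^{n_1}\cdots x_k^{n_k}$; $\sum_{\mathbf{n}=\mathbf{0}}^{\infty}$ is the sum over all $\mathbf{n}\in\mathbb{Z}_{\ge0}^k$. $(a)_n=a(a+1)\cdots(a+n-1)$, $(a)_0=1$, is the Pochhammer symbol. Powers are principal branches. For every $\alpha\in\mathbb{C}$, Erdélyi's multivariate Laguerre polynomials $L_{\mathbf{n}}^{(\alpha)}(\mathbf{x})=L_{n_1,\ldots,n_k}^{(\alpha)}(x_1,\ldots,x_k)$ are defined by $$(1-\langle\mathbf{z}\rangle)^{-\alpha-1}\exp\left\{-\frac{\langle\mathbf{x}\circ\mathbf{z}\rangle}{1-\langle\mathbf{z}\rangle}\right\}=\sum_{\mathbf{n}=\mathbf{0}}^{\infty}L_{\mathbf{n}}^{(\alpha)}(\mathbf{x})\,\mathbf{z}^{\mathbf{n}},\qquad |z_1|+\cdots+|z_k|<1.$$ Humbert's function: $\Phi_1[a,b;c;x,y]:=\sum_{m,n=0}^{\infty}\frac{(a)_{m+n}(b)_m}{(c)_{m+n}}\frac{x^m}{m!}\frac{y^n}{n!}$ for $|x|<1$, $|y|<\infty$, $c\notin\mathbb{Z}_{\le0}$. *)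

theory Defs
  imports "HOL-Analysis.Analysis"
begin

text \<open>
  Vectors of dimension \<open>k\<close> are elements of \<open>complex ^ 'k\<close>, multi-indices elements of
  \<open>nat ^ 'k\<close>, with \<open>k = CARD('k)\<close>. The library's product \<open>x * y\<close> of vectors is the
  componentwise product.
\<close>

definition vtotal :: "'a::comm_monoid_add ^ 'k \<Rightarrow> 'a" ("\<langle>_\<rangle>")
  where "\<langle>x\<rangle> = (\<Sum>i\<in>UNIV. x $ i)"

definition mpow :: "complex ^ 'k \<Rightarrow> nat ^ 'k \<Rightarrow> complex"
  where "mpow x n = (\<Prod>i\<in>UNIV. x $ i ^ (n $ i))"

text \<open>
  The generating function determines its coefficients: it is holomorphic on the complete
  Reinhardt domain \<open>\<bar>z\<^sub>1\<bar> + \<dots> + \<bar>z\<^sub>k\<bar> < 1\<close>, so that it is the (absolute) sum of exactly one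
  power series there.
\<close>

definition mlaguerre :: "complex \<Rightarrow> complex ^ 'k \<Rightarrow> nat ^ 'k \<Rightarrow> complex"
  where "mlaguerre \<alpha> x = (THE c. \<forall>z. (\<Sum>i\<in>UNIV. cmod (z $ i)) < 1 \<longrightarrow>
    ((\<lambda>n. c n * mpow z n) has_sum
      (1 - \<langle>z\<rangle>) powr (- \<alpha> - 1) * exp (- (\<langle>x * z\<rangle> / (1 - \<langle>z\<rangle>)))) UNIV)"

text \<open>Meaningful for \<open>cmod x < 1\<close> and \<open>c \<notin> \<int>\<^sub>\<le>\<^sub>0\<close>, where the double series converges absolutely.\<close>

definition humbert_Phi1 :: "complex \<Rightarrow> complex \<Rightarrow> complex \<Rightarrow> complex \<Rightarrow> complex \<Rightarrow> complex"
  where "humbert_Phi1 a b c x y = (\<Sum>\<^sub>\<infinity>(m, n)\<in>UNIV.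
    pochhammer a (m + n) * pochhammer b m / pochhammer c (m + n) * (x ^ m / fact m) * (y ^ n / fact n))"

end

theory Submission
  imports Defs
begin

text \<open>
  Write \<open>s = \<langle>z\<rangle>\<close> and \<open>t = \<langle>x * z\<rangle>\<close>. Expanding first the exponential and then the powers of
  \<open>1 - s\<close>, the generating function of the Laguerre polynomials becomes the double series
  \<open>\<Sum>m j. (a + 1 + j)\<^sub>m * s\<^sup>m / m! * (- t)\<^sup>j / j!\<close>. By the multinomial theorem \<open>s\<^sup>m / m!\<close> is the sum
  of \<open>z\<^sup>p / p!\<close> over the multi-indices \<open>p\<close> of total \<open>m\<close>, and likewise for \<open>(- t)\<^sup>j / j!\<close>. Collecting
  the terms with \<open>p + q = n\<close> yields the explicit form
  \<open>L\<^sub>n(x) = \<Sum>p + q = n. (a + 1 + \<langle>q\<rangle>)\<^sub>\<langle>\<^sub>p\<^sub>\<rangle> / p! * (- x)\<^sup>q / q!\<close>.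

  At the lowered parameter \<open>a = - \<beta> - \<langle>n\<rangle>\<close> the shift by \<open>\<langle>q\<rangle>\<close> cancels and the Pochhammer symbol is
  \<open>(1 - \<beta> - \<langle>p\<rangle>)\<^sub>\<langle>\<^sub>p\<^sub>\<rangle>\<close>, that is \<open>(\<beta>)\<^sub>\<langle>\<^sub>p\<^sub>\<rangle>\<close> up to the sign \<open>(- 1)\<close> to the power \<open>\<langle>p\<rangle>\<close>. The factors of
  the summand depending on \<open>p\<close> and on \<open>q\<close> then decouple, and as \<open>(\<alpha>)\<^sub>\<langle>\<^sub>n\<^sub>\<rangle> / (\<gamma>)\<^sub>\<langle>\<^sub>n\<^sub>\<rangle>\<close> sees only
  \<open>\<langle>p\<rangle> + \<langle>q\<rangle>\<close>, the same regrouping read backwards turns the Laguerre series into the double series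
  of \<open>\<Phi>\<^sub>1\<close>. For \<open>\<alpha> = \<gamma>\<close> that double series is the product of a binomial and an exponential series.

  Both regroupings are \<open>double_series_expansion\<close>. The values of the double series come from
  \<open>binomial_exp_double_has_sum\<close>. That the explicit form is what the generating function determines
  is \<open>mlaguerre_eq\<close>, which rests on the identity theorem \<open>power_series_identity\<close> for power series in
  several variables. Absolute convergence of \<open>\<Phi>\<^sub>1\<close> holds as \<open>(\<alpha>)\<^sub>n / (\<gamma>)\<^sub>n\<close> grows slower than every
  geometric sequence of ratio above 1.
\<close>

section \<open>Multi-indices and the multinomial theorem\<close>

lemma finite_vtotal_eq: "finite {n :: nat ^ 'k. \<langle>n\<rangle> = m}"
proof -
  have "finite {f :: 'k \<Rightarrow> nat. \<forall>i. (i \<in> UNIV \<longrightarrow> f i \<in> {..m}) \<and> (i \<notin> UNIV \<longrightarrow> f i = 0)}"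
    by (rule finite_set_of_finite_funs) auto
  then have "finite (vec_lambda ` {f :: 'k \<Rightarrow> nat. \<forall>i. f i \<le> m})"
    by simp
  moreover have "{n :: nat ^ 'k. \<langle>n\<rangle> = m} \<subseteq> vec_lambda ` {f :: 'k \<Rightarrow> nat. \<forall>i. f i \<le> m}"
  proof
    fix n :: "nat ^ 'k"
    assume "n \<in> {n. \<langle>n\<rangle> = m}"
    then have "n $ i \<le> m" for i
      using member_le_sum[of i UNIV "\<lambda>i. n $ i"] by (simp add: vtotal_def)
    then show "n \<in> vec_lambda ` {f. \<forall>i. f i \<le> m}"
      by (intro image_eqI[of _ _ "vec_nth n"]) auto
  qed
  ultimately show ?thesis
    by (rule finite_subset[rotated])
qed

lemma vtotal_add: "\<langle>p + q\<rangle> = \<langle>p\<rangle> + \<langle>q\<rangle>"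
  by (simp add: vtotal_def sum.distrib)

lemma vtotal_uminus: "\<langle>- x\<rangle> = - \<langle>x :: 'a::ab_group_add ^ 'k\<rangle>"
  by (simp add: vtotal_def sum_negf)

lemma finite_convolution_fiber: "finite {(p, q). p + q = (n :: nat ^ 'k)}"
proof -
  let ?F = "\<Union>m \<in> {..\<langle>n\<rangle>}. {p :: nat ^ 'k. \<langle>p\<rangle> = m}"
  have "finite (?F \<times> ?F)"
    using finite_vtotal_eq by blast
  moreover have "{(p, q). p + q = n} \<subseteq> ?F \<times> ?F"
    by (auto simp: vtotal_add)
  ultimately show ?thesis
    by (rule finite_subset[rotated])
qed

lemma mpow_add: "mpow z (p + q) = mpow z p * mpow z q"
  by (simp add: mpow_def power_add prod.distrib)

text \<open>
  The terms \<open>z\<^sup>n / n!\<close> of the exponential series in several variables. With the factorials built in,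
  the multinomial theorem carries no coefficients.
\<close>

definition exp_monomial :: "'a::field_char_0 ^ 'k \<Rightarrow> nat ^ 'k \<Rightarrow> 'a"
  where "exp_monomial z n = (\<Prod>i\<in>UNIV. z $ i ^ (n $ i) / fact (n $ i))"

lemma exp_monomial_mult: "exp_monomial (x * z) n = exp_monomial x n * mpow z n"
  by (simp add: exp_monomial_def mpow_def power_mult_distrib flip: prod.distrib)

lemma exp_monomial_uminus: "exp_monomial (- z) n = (-1) ^ \<langle>n\<rangle> * exp_monomial z n"
proof -
  have "exp_monomial (- z) n = (\<Prod>i\<in>UNIV. (-1) ^ (n $ i) * (z $ i ^ (n $ i) / fact (n $ i)))"
    unfolding exp_monomial_def by (intro prod.cong refl) (simp add: power_minus[of "z $ i" for i])
  also have "\<dots> = (\<Prod>i\<in>UNIV. (-1) ^ (n $ i)) * exp_monomial z n"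
    unfolding exp_monomial_def by (rule prod.distrib)
  finally show ?thesis
    by (simp add: vtotal_def power_sum)
qed

lemma norm_exp_monomial:
  "norm (exp_monomial z n) = exp_monomial (\<chi> i. norm (z $ i)) n"
  for z :: "'a::real_normed_field ^ 'k"
  by (simp add: exp_monomial_def norm_divide norm_power flip: prod_norm)

lemma exp_monomial_raise:
  fixes z :: "'a::field_char_0 ^ 'k"
  shows "of_nat (Suc (q $ i)) * exp_monomial z (q + axis i 1) = z $ i * exp_monomial z q"
proof -
  have "exp_monomial z (q + axis i 1)
      = z $ i ^ Suc (q $ i) / fact (Suc (q $ i)) * (\<Prod>j\<in>UNIV - {i}. z $ j ^ (q $ j) / fact (q $ j))"
    unfolding exp_monomial_def by (subst prod.remove[of _ i]) (auto simp: axis_def intro!: prod.cong)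
  also have "of_nat (Suc (q $ i)) * \<dots>
      = z $ i * (z $ i ^ (q $ i) / fact (q $ i) * (\<Prod>j\<in>UNIV - {i}. z $ j ^ (q $ j) / fact (q $ j)))"
    by (simp add: divide_simps fact_Suc del: of_nat_Suc)
  also have "z $ i ^ (q $ i) / fact (q $ i) * (\<Prod>j\<in>UNIV - {i}. z $ j ^ (q $ j) / fact (q $ j))
      = exp_monomial z q"
    unfolding exp_monomial_def by (subst (2) prod.remove[of _ i]) auto
  finally show ?thesis .
qed

lemma vtotal_axis: "\<langle>axis i (1 :: nat)\<rangle> = 1"
  by (simp add: vtotal_def axis_def)

text \<open>
  The induction multiplies by \<open>m + 1 = \<langle>n\<rangle>\<close>, which splits each term according to the variable that is
  to be lowered: \<open>n\<^sub>i * z\<^sup>n / n! = z\<^sub>i * z\<^sup>q / q!\<close> for \<open>n = q + e\<^sub>i\<close>.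
\<close>

lemma multinomial_sum:
  fixes z :: "'a::field_char_0 ^ 'k"
  shows "(\<Sum>n | \<langle>n\<rangle> = m. exp_monomial z n) = \<langle>z\<rangle> ^ m / fact m"
proof (induction m)
  case 0
  have "{n :: nat ^ 'k. \<langle>n\<rangle> = 0} = {0}"
    by (auto simp: vtotal_def vec_eq_iff)
  then show ?case
    by (simp add: exp_monomial_def)
next
  case (Suc m)
  have shift: "(\<Sum>n | \<langle>n\<rangle> = Suc m. of_nat (n $ i) * exp_monomial z n)
      = (\<Sum>q | \<langle>q\<rangle> = m. z $ i * exp_monomial z q)" for i
  proof -
    have "(\<Sum>n | \<langle>n\<rangle> = Suc m. of_nat (n $ i) * exp_monomial z n)
        = (\<Sum>n | \<langle>n\<rangle> = Suc m \<and> n $ i \<noteq> 0. of_nat (n $ i) * exp_monomial z n)"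
      by (rule sum.mono_neutral_right) (auto intro: finite_vtotal_eq)
    also have "\<dots> = (\<Sum>q | \<langle>q\<rangle> = m. of_nat (Suc (q $ i)) * exp_monomial z (q + axis i 1))"
    proof (rule sum.reindex_bij_witness[of _ "\<lambda>q. q + axis i 1" "\<lambda>n. n - axis i 1"])
      fix n :: "nat ^ 'k"
      assume n: "n \<in> {n. \<langle>n\<rangle> = Suc m \<and> n $ i \<noteq> 0}"
      then show eq: "n - axis i 1 + axis i 1 = n"
        by (auto simp: vec_eq_iff axis_def)
      then show "n - axis i 1 \<in> {q. \<langle>q\<rangle> = m}"
        using n vtotal_add[of "n - axis i 1" "axis i 1"] by (simp add: vtotal_axis del: One_nat_def)
      show "of_nat (Suc ((n - axis i 1) $ i)) * exp_monomial z (n - axis i 1 + axis i 1)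
          = of_nat (n $ i) * exp_monomial z n"
        using n by (subst eq) (simp add: axis_def)
    next
      fix q :: "nat ^ 'k"
      assume "q \<in> {q. \<langle>q\<rangle> = m}"
      then show "q + axis i 1 \<in> {n. \<langle>n\<rangle> = Suc m \<and> n $ i \<noteq> 0}"
        by (simp add: vtotal_add vtotal_axis del: One_nat_def)
    qed (simp add: vec_eq_iff)
    finally show ?thesis
      by (simp only: exp_monomial_raise)
  qed
  have "of_nat (Suc m) * (\<Sum>n | \<langle>n\<rangle> = Suc m. exp_monomial z n)
      = (\<Sum>n | \<langle>n\<rangle> = Suc m. (\<Sum>i\<in>UNIV. of_nat (n $ i) * exp_monomial z n))"
    unfolding sum_distrib_left
    by (intro sum.cong refl) (simp add: vtotal_def flip: sum_distrib_right of_nat_sum)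
  also have "\<dots> = (\<Sum>i\<in>UNIV. \<Sum>n | \<langle>n\<rangle> = Suc m. of_nat (n $ i) * exp_monomial z n)"
    by (rule sum.swap)
  also have "\<dots> = \<langle>z\<rangle> * (\<Sum>q | \<langle>q\<rangle> = m. exp_monomial z q)"
    unfolding shift sum_distrib_left[symmetric] sum_distrib_right[symmetric]
    by (simp only: vtotal_def[of z])
  also have "\<dots> = of_nat (Suc m) * (\<langle>z\<rangle> ^ Suc m / fact (Suc m))"
    by (simp add: Suc.IH divide_simps fact_Suc del: of_nat_Suc)
  finally show ?case
    by (simp only: mult_left_cancel of_nat_neq_0 not_False_eq_True)
qed

section \<open>Regrouping sums along maps with finite fibers\<close>

lemma bij_betw_fibers: "bij_betw snd (SIGMA b:UNIV. {a. h a = b}) UNIV"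
  by (rule bij_betwI[of _ _ _ "\<lambda>a. (h a, a)"]) auto

lemma has_sum_fibers:
  fixes f :: "'a \<Rightarrow> 'b::banach"
  assumes "(f has_sum S) UNIV" and "\<And>b. finite {a. h a = b}"
  shows "((\<lambda>b. \<Sum>a | h a = b. f a) has_sum S) UNIV"
proof (rule has_sum_SigmaD)
  show "((\<lambda>x. f (snd x)) has_sum S) (SIGMA b:UNIV. {a. h a = b})"
    using assms(1) by (subst has_sum_reindex_bij_betw[OF bij_betw_fibers])
qed (simp add: assms(2))

lemma abs_summable_fibers:
  fixes f :: "'a \<Rightarrow> 'b::banach"
  assumes "(\<lambda>b. \<Sum>a | h a = b. norm (f a)) summable_on UNIV" and "\<And>b. finite {a. h a = b}"
  shows "f abs_summable_on UNIV"
proof -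
  have "(\<lambda>x. norm (f (snd x))) summable_on (SIGMA b:UNIV. {a. h a = b})"
    by (rule summable_on_SigmaI[OF _ assms(1)]) (auto simp: assms(2))
  then show ?thesis
    by (simp add: summable_on_reindex_bij_betw[OF bij_betw_fibers, of "\<lambda>x. norm (f x)"])
qed

lemma double_multinomial_sum:
  fixes d :: "nat \<Rightarrow> nat \<Rightarrow> 'a::field_char_0" and v w :: "'a ^ 'k"
  shows "(\<Sum>(p, q) \<in> {p. \<langle>p\<rangle> = m} \<times> {q. \<langle>q\<rangle> = j}. d \<langle>p\<rangle> \<langle>q\<rangle> * exp_monomial v p * exp_monomial w q)
    = d m j * (\<langle>v\<rangle> ^ m / fact m) * (\<langle>w\<rangle> ^ j / fact j)"
proof -
  have "(\<Sum>(p, q) \<in> {p. \<langle>p\<rangle> = m} \<times> {q. \<langle>q\<rangle> = j}. d \<langle>p\<rangle> \<langle>q\<rangle> * exp_monomial v p * exp_monomial w q)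
      = (\<Sum>(p, q) \<in> {p. \<langle>p\<rangle> = m} \<times> {q. \<langle>q\<rangle> = j}. d m j * (exp_monomial v p * exp_monomial w q))"
    by (rule sum.cong) (auto simp: mult.assoc)
  also have "\<dots> = d m j * (\<Sum>(p, q) \<in> {p. \<langle>p\<rangle> = m} \<times> {q. \<langle>q\<rangle> = j}. exp_monomial v p * exp_monomial w q)"
    by (simp only: sum_distrib_left case_prod_unfold)
  also have "\<dots> = d m j * ((\<Sum>p | \<langle>p\<rangle> = m. exp_monomial v p) * (\<Sum>q | \<langle>q\<rangle> = j. exp_monomial w q))"
    by (simp only: sum_product sum.cartesian_product)
  finally show ?thesis
    by (simp only: multinomial_sum mult.assoc)
qed

text \<open>
  Both sides are regroupings of one family indexed by the pairs \<open>(p, q)\<close>: along \<open>(\<langle>p\<rangle>, \<langle>q\<rangle>)\<close>, where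
  the fiber sums are multinomial, and along \<open>p + q\<close>. The first grouping, applied to the norms, also
  shows that the family is absolutely summable; this is why the hypothesis has the sums of the norms
  of the components where the value has \<open>\<langle>z\<rangle>\<close> and \<open>\<langle>y\<rangle>\<close>.
\<close>

lemma double_series_expansion:
  fixes c :: "nat \<Rightarrow> nat \<Rightarrow> 'a::{real_normed_field, banach}" and y z :: "'a ^ 'k"
  assumes abs: "(\<lambda>(m, j). norm (c m j) * ((\<Sum>i\<in>UNIV. norm (z $ i)) ^ m / fact m)
      * ((\<Sum>i\<in>UNIV. norm (y $ i)) ^ j / fact j)) summable_on UNIV"
    and sum: "((\<lambda>(m, j). c m j * (\<langle>z\<rangle> ^ m / fact m) * (\<langle>y\<rangle> ^ j / fact j)) has_sum S) UNIV"
  shows "((\<lambda>n. \<Sum>(p, q) | p + q = n. c \<langle>p\<rangle> \<langle>q\<rangle> * exp_monomial z p * exp_monomial y q)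
    has_sum S) UNIV"
proof -
  let ?g = "\<lambda>(p, q). c \<langle>p\<rangle> \<langle>q\<rangle> * exp_monomial z p * exp_monomial y q"
  let ?h = "\<lambda>(p :: nat ^ 'k, q :: nat ^ 'k). (\<langle>p\<rangle>, \<langle>q\<rangle>)"
  have fiber: "{a. ?h a = (m, j)} = {p. \<langle>p\<rangle> = m} \<times> {q. \<langle>q\<rangle> = j}" for m j
    by auto
  have fin: "finite {a. ?h a = b}" for b
    by (cases b) (simp only: fiber finite_cartesian_product finite_vtotal_eq)
  have "(\<lambda>b. \<Sum>a | ?h a = b. norm (?g a)) summable_on UNIV"
  proof -
    have "(\<Sum>a | ?h a = (m, j). norm (?g a)) = norm (c m j) * ((\<Sum>i\<in>UNIV. norm (z $ i)) ^ m / fact m)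
      * ((\<Sum>i\<in>UNIV. norm (y $ i)) ^ j / fact j)" for m j
      using double_multinomial_sum[where d = "\<lambda>m j. norm (c m j)"
          and v = "\<chi> i. norm (z $ i)" and w = "\<chi> i. norm (y $ i)"]
      unfolding fiber by (simp add: case_prod_unfold norm_mult norm_exp_monomial vtotal_def[of "vec_lambda _"])
    then have "(\<lambda>b. \<Sum>a | ?h a = b. norm (?g a)) = (\<lambda>(m, j). norm (c m j)
      * ((\<Sum>i\<in>UNIV. norm (z $ i)) ^ m / fact m) * ((\<Sum>i\<in>UNIV. norm (y $ i)) ^ j / fact j))"
      by (intro ext) (simp only: split_paired_all prod.case)
    then show ?thesis
      using abs by (simp only:)
  qed
  then have "?g abs_summable_on UNIV"
    using fin by (rule abs_summable_fibers)
  then obtain S' where S': "(?g has_sum S') UNIV"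
    using abs_summable_summable summable_on_def by blast
  have "((\<lambda>b. \<Sum>a | ?h a = b. ?g a) has_sum S') UNIV"
    using S' fin by (rule has_sum_fibers)
  moreover have "(\<Sum>a | ?h a = (m, j). ?g a) = c m j * (\<langle>z\<rangle> ^ m / fact m) * (\<langle>y\<rangle> ^ j / fact j)" for m j
    unfolding fiber by (rule double_multinomial_sum)
  then have "(\<lambda>b. \<Sum>a | ?h a = b. ?g a)
      = (\<lambda>(m, j). c m j * (\<langle>z\<rangle> ^ m / fact m) * (\<langle>y\<rangle> ^ j / fact j))"
    by (intro ext) (simp only: split_paired_all prod.case)
  ultimately have "((\<lambda>(m, j). c m j * (\<langle>z\<rangle> ^ m / fact m) * (\<langle>y\<rangle> ^ j / fact j)) has_sum S') UNIV"
    by (simp only:)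
  then have "S' = S"
    using sum has_sum_unique by blast
  then have "((\<lambda>n. \<Sum>a | (\<lambda>(p, q). p + q) a = n. ?g a) has_sum S) UNIV"
    using S' by (intro has_sum_fibers) (auto simp: case_prod_unfold intro: finite_convolution_fiber[unfolded case_prod_unfold])
  then show ?thesis
    by (simp add: case_prod_unfold)
qed

section \<open>The identity theorem for power series in several variables\<close>

lemma power_series_zero_coeffs:
  fixes e :: "nat \<Rightarrow> complex"
  assumes "0 < r" and "\<And>t. norm t < r \<Longrightarrow> (\<lambda>n. e n * t ^ n) sums 0"
  shows "e n = 0"
proof -
  have "conv_radius e \<ge> r"
    using assms(2) by (intro conv_radius_geI_ex') (auto simp: sums_iff)
  then have "fps_conv_radius (Abs_fps e) > 0"
    using \<open>0 < r\<close> by (auto simp: fps_conv_radius_def intro: less_le_trans[rotated])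
  moreover have "eventually (\<lambda>t. eval_fps (Abs_fps e) t = eval_fps 0 t) (nhds 0)"
    unfolding eventually_nhds_metric using assms
    by (intro exI[of _ r]) (auto simp: eval_fps_def sums_iff)
  ultimately have "Abs_fps e = 0"
    by (intro eval_fps_eqD) auto
  then show ?thesis
    by (metis fps_nth_Abs_fps fps_zero_nth)
qed

text \<open>
  On the curve \<open>z\<^sub>i = t\<close> to the power \<open>w\<^sub>i\<close> the series becomes a power series in the single variable
  \<open>t\<close>, whose coefficients are the sums of \<open>d\<close> over the multi-indices of equal weight. These sums are
  finite because the weights are positive.
\<close>

lemma weighted_slice_zero:
  fixes d :: "nat ^ 'k \<Rightarrow> complex" and w :: "'k \<Rightarrow> nat"
  assumes w: "\<And>i. w i \<ge> 1"
    and zero: "\<And>z :: complex ^ 'k. (\<Sum>i\<in>UNIV. cmod (z $ i)) < 1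
      \<Longrightarrow> ((\<lambda>n. d n * mpow z n) has_sum 0) UNIV"
  shows "(\<Sum>n | (\<Sum>i\<in>UNIV. w i * n $ i) = N. d n) = 0"
proof -
  let ?h = "\<lambda>n :: nat ^ 'k. \<Sum>i\<in>UNIV. w i * n $ i"
  have fin: "finite {n. ?h n = b}" for b
  proof (rule finite_subset)
    show "{n. ?h n = b} \<subseteq> (\<Union>m \<in> {..b}. {n. \<langle>n\<rangle> = m})"
      using w by (force simp: vtotal_def intro!: sum_mono)
  qed (auto intro: finite_vtotal_eq)
  \<comment> \<open>Small enough for the curve to stay in the domain: its \<open>CARD('k)\<close> components are bounded by \<open>\<bar>t\<bar>\<close>.\<close>
  let ?r = "1 / (1 + real CARD('k))"
  have "(\<lambda>N. (\<Sum>n | ?h n = N. d n) * t ^ N) sums 0" if t: "norm t < ?r" for t :: complex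
  proof -
    have r: "?r \<le> 1"
      by simp
    have "(\<Sum>i\<in>UNIV. cmod ((\<chi> i. t ^ w i) $ i)) \<le> (\<Sum>i\<in>(UNIV :: 'k set). norm t)"
    proof (rule sum_mono)
      fix i
      have "norm t ^ w i \<le> norm t ^ 1"
        using less_imp_le[OF less_le_trans[OF t r]] w by (intro power_decreasing) auto
      then show "cmod ((\<chi> i. t ^ w i) $ i) \<le> norm t"
        by (simp add: norm_power)
    qed
    also have "\<dots> < 1"
    proof -
      have "norm t * (1 + real CARD('k)) < 1"
        using t by (simp add: field_simps)
      then show ?thesis
        by (simp add: algebra_simps) (use norm_ge_zero[of t] in linarith)
    qed
    finally have "((\<lambda>n. d n * mpow (\<chi> i. t ^ w i) n) has_sum 0) UNIV"
      by (rule zero)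
    also have "(\<lambda>n. d n * mpow (\<chi> i. t ^ w i) n) = (\<lambda>n. d n * t ^ ?h n)"
      by (simp add: mpow_def power_sum flip: power_mult)
    finally have "((\<lambda>b. \<Sum>n | ?h n = b. d n * t ^ ?h n) has_sum 0) UNIV"
      using fin by (rule has_sum_fibers)
    then show ?thesis
      by (intro has_sum_imp_sums) (simp add: sum_distrib_right)
  qed
  then show ?thesis
    by (intro power_series_zero_coeffs[of ?r]) auto
qed

text \<open>
  Distinct multi-indices, read as coefficient lists, are distinct polynomials. Two of them agree at
  finitely many points only, so some base \<open>B\<close> tells all elements of \<open>F\<close> apart, and the weights are
  powers of \<open>B\<close>.
\<close>

lemma separating_weights:
  fixes F :: "(nat ^ 'k) set"
  assumes "finite F"
  obtains v :: "'k \<Rightarrow> nat" where "inj_on (\<lambda>n. \<Sum>i\<in>UNIV. v i * n $ i) F"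
proof -
  obtain f :: "'k \<Rightarrow> nat" where f: "inj f"
    using finite_imp_inj_to_nat_seg[of "UNIV :: 'k set"] by auto
  define P :: "nat ^ 'k \<Rightarrow> int poly" where "P n = (\<Sum>i\<in>UNIV. monom (int (n $ i)) (f i))" for n
  have P_inj: "n = n'" if "P n = P n'" for n n'
  proof -
    have "poly.coeff (P m) (f i) = int (m $ i)" for m i
      using inj_eq[OF f] by (simp add: P_def coeff_sum)
    then show ?thesis
      using that by (metis of_nat_eq_iff vec_eq_iff)
  qed
  have "finite (\<Union>n \<in> F. \<Union>n' \<in> F - {n}. {x. poly (P n - P n') x = 0})"
    using assms P_inj by (intro finite_UN_I poly_roots_finite) auto
  then have "finite (int -` (\<Union>n \<in> F. \<Union>n' \<in> F - {n}. {x. poly (P n - P n') x = 0}))"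
    by (intro finite_vimageI) (auto simp: inj_on_def)
  then obtain B where "B \<notin> int -` (\<Union>n \<in> F. \<Union>n' \<in> F - {n}. {x. poly (P n - P n') x = 0})"
    using ex_new_if_finite[OF infinite_UNIV_nat] by blast
  then have B: "int B \<notin> (\<Union>n \<in> F. \<Union>n' \<in> F - {n}. {x. poly (P n - P n') x = 0})"
    by simp
  have "poly (P n) (int B) = int (\<Sum>i\<in>UNIV. B ^ f i * n $ i)" for n
    by (simp add: P_def poly_sum poly_monom mult.commute)
  then have "inj_on (\<lambda>n. \<Sum>i\<in>UNIV. B ^ f i * n $ i) F"
    using B unfolding inj_on_def by (metis (mono_tags, lifting) DiffI UN_I empty_iff insert_iff
        mem_Collect_eq poly_diff right_minus_eq)
  then show ?thesis
    by (rule that)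
qed

text \<open>
  It suffices to find positive weights for which \<open>m\<close> is the only multi-index of its weight. Weights
  \<open>Q + v\<^sub>i\<close> have this property if \<open>v\<close> separates the finitely many multi-indices whose total is at
  most \<open>\<langle>m\<rangle>\<close> and \<open>Q\<close> exceeds all their \<open>v\<close>-weights: a larger total then means a larger weight, and
  among the others the \<open>v\<close>-weight is the remainder modulo \<open>Q\<close>.
\<close>

lemma power_series_identity:
  fixes d :: "nat ^ 'k \<Rightarrow> complex"
  assumes zero: "\<And>z :: complex ^ 'k. (\<Sum>i\<in>UNIV. cmod (z $ i)) < 1
      \<Longrightarrow> ((\<lambda>n. d n * mpow z n) has_sum 0) UNIV"
  shows "d m = 0"
proof -
  define F where "F = (\<Union>l \<in> {..\<langle>m\<rangle>}. {n :: nat ^ 'k. \<langle>n\<rangle> = l})"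
  have F: "finite F" "m \<in> F"
    by (auto simp: F_def intro: finite_vtotal_eq)
  obtain v :: "'k \<Rightarrow> nat" where v: "inj_on (\<lambda>n. \<Sum>i\<in>UNIV. v i * n $ i) F"
    using separating_weights[OF F(1)] .
  define V where "V n = (\<Sum>i\<in>UNIV. v i * n $ i)" for n :: "nat ^ 'k"
  define Q where "Q = Suc (\<Sum>n\<in>F. V n)"
  have V_less: "V n < Q" if "n \<in> F" for n
    using member_le_sum[of n F V] that F(1) by (simp add: Q_def)
  have weight: "(\<Sum>i\<in>UNIV. (Q + v i) * n $ i) = Q * \<langle>n\<rangle> + V n" for n :: "nat ^ 'k"
    by (simp add: V_def vtotal_def sum_distrib_left sum.distrib distrib_right)
  have "{n :: nat ^ 'k. (\<Sum>i\<in>UNIV. (Q + v i) * n $ i) = Q * \<langle>m\<rangle> + V m} = {m}"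
  proof (intro equalityI subsetI)
    fix n :: "nat ^ 'k"
    assume "n \<in> {n. (\<Sum>i\<in>UNIV. (Q + v i) * n $ i) = Q * \<langle>m\<rangle> + V m}"
    then have eq: "Q * \<langle>n\<rangle> + V n = Q * \<langle>m\<rangle> + V m"
      by (simp add: weight)
    have "\<langle>n\<rangle> \<le> \<langle>m\<rangle>"
    proof (rule ccontr)
      assume "\<not> \<langle>n\<rangle> \<le> \<langle>m\<rangle>"
      then have "Q * Suc \<langle>m\<rangle> \<le> Q * \<langle>n\<rangle>"
        by (intro mult_le_mono2) auto
      then show False
        using eq V_less[OF F(2)] by simp
    qed
    then have n: "n \<in> F"
      by (auto simp: F_def)
    have "V n = V m"
      using arg_cong[OF eq, of "\<lambda>a. a mod Q"] V_less[OF n] V_less[OF F(2)] by simp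
    then show "n \<in> {m}"
      using inj_onD[OF v _ n F(2)] by (simp add: V_def)
  qed (simp add: weight)
  then show ?thesis
    using weighted_slice_zero[of "\<lambda>i. Q + v i" d "Q * \<langle>m\<rangle> + V m", OF _ zero] by (simp add: Q_def)
qed

section \<open>Binomial and exponential double series\<close>

lemma norm_pochhammer_le:
  fixes a :: "'a::real_normed_field"
  assumes "norm a \<le> r"
  shows "norm (pochhammer a n) \<le> pochhammer r n"
proof -
  have "norm (a + of_nat i) \<le> r + of_nat i" for i
    using norm_triangle_ineq[of a "of_nat i"] assms by simp
  then show ?thesis
    unfolding pochhammer_prod prod_norm[symmetric] by (intro prod_mono) auto
qed

lemma pochhammer_sums_complex:
  fixes a z :: complex
  assumes "norm z < 1"
  shows "(\<lambda>m. pochhammer a m * (z ^ m / fact m)) sums (1 - z) powr (- a)"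
proof -
  have "(- a gchoose m) * (- z) ^ m = pochhammer a m * (z ^ m / fact m)" for m
    by (simp add: gbinomial_pochhammer power_minus[of z])
  then show ?thesis
    using gen_binomial_complex[of "- z" "- a"] assms by simp
qed

lemma pochhammer_sums_real:
  fixes a z :: real
  assumes "\<bar>z\<bar> < 1"
  shows "(\<lambda>m. pochhammer a m * (z ^ m / fact m)) sums (1 - z) powr (- a)"
proof -
  have "(- a gchoose m) * (- z) ^ m = pochhammer a m * (z ^ m / fact m)" for m
    by (simp add: gbinomial_pochhammer power_minus[of z])
  then show ?thesis
    using gen_binomial_real[of "- z" "- a"] assms by simp
qed

text \<open>
  Summing over \<open>m\<close> first gives \<open>(1 - S) powr (- r) * (Y / (1 - S)\<^sup>d)\<^sup>j / j!\<close>, an exponential series.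
  The case \<open>d = 1\<close> majorises the generating function of the Laguerre polynomials; the case \<open>d = 0\<close>,
  where the two summations are independent, majorises \<open>\<Phi>\<^sub>1\<close>.
\<close>

lemma binomial_exp_double_summable:
  fixes r S Y :: real
  assumes "0 \<le> r" "0 \<le> S" "S < 1" "0 \<le> Y"
  shows "(\<lambda>(m, j). pochhammer (r + of_nat (d * j)) m * (S ^ m / fact m) * (Y ^ j / fact j))
    summable_on UNIV"
proof -
  have nonneg: "0 \<le> pochhammer (r + of_nat (d * j)) m" for j m
    unfolding pochhammer_prod using assms(1) by (intro prod_nonneg) auto
  have "(\<lambda>(j, m). pochhammer (r + of_nat (d * j)) m * (S ^ m / fact m) * (Y ^ j / fact j))
      summable_on UNIV \<times> UNIV"
  proof (rule summable_on_SigmaI)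
    fix j
    have "((\<lambda>m. pochhammer (r + of_nat (d * j)) m * (S ^ m / fact m))
        has_sum (1 - S) powr (- (r + of_nat (d * j)))) UNIV"
      using nonneg assms by (intro sums_nonneg_imp_has_sum pochhammer_sums_real mult_nonneg_nonneg) auto
    also have "(1 - S) powr (- (r + of_nat (d * j))) = (1 - S) powr (- r) / ((1 - S) ^ d) ^ j"
      unfolding minus_add_distrib add_uminus_conv_diff powr_diff
      using assms by (simp only: powr_realpow power_mult diff_gt_0_iff_gt)
    finally show "((\<lambda>m. case (j, m) of (j, m) \<Rightarrow>
        pochhammer (r + of_nat (d * j)) m * (S ^ m / fact m) * (Y ^ j / fact j))
        has_sum (1 - S) powr (- r) / ((1 - S) ^ d) ^ j * (Y ^ j / fact j)) UNIV"
      unfolding prod.case by (rule has_sum_cmult_left)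
  next
    have "(\<lambda>j. (1 - S) powr (- r) * ((Y / (1 - S) ^ d) ^ j / fact j)) summable_on UNIV"
      using assms by (intro summable_on_cmult_right summable_nonneg_imp_summable_on)
        (use summable_exp[of "Y / (1 - S) ^ d"] in \<open>auto simp: field_simps\<close>)
    then show "(\<lambda>j. (1 - S) powr (- r) / ((1 - S) ^ d) ^ j * (Y ^ j / fact j)) summable_on UNIV"
      by (simp add: power_divide)
  qed (use nonneg assms in auto)
  then show ?thesis
    by (subst (asm) summable_on_swap) simp
qed

lemma binomial_exp_double_has_sum:
  fixes b s y :: complex
  assumes "norm s < 1"
  shows "((\<lambda>(m, j). pochhammer (b + of_nat (d * j)) m * (s ^ m / fact m) * (y ^ j / fact j))
    has_sum (1 - s) powr (- b) * exp (y / (1 - s) ^ d)) UNIV"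
proof -
  let ?f = "\<lambda>(m, j). pochhammer (b + of_nat (d * j)) m * (s ^ m / fact m) * (y ^ j / fact j)"
  have bound: "norm (pochhammer (b + of_nat (d * j)) m) \<le> pochhammer (norm b + of_nat (d * j)) m" for j m
    using norm_triangle_ineq[of b "of_nat (d * j)"] by (intro norm_pochhammer_le) (simp only: norm_of_nat)
  have "?f summable_on UNIV"
  proof (rule abs_summable_summable, rule Infinite_Sum.abs_summable_on_comparison_test')
    show "(\<lambda>(m, j). pochhammer (norm b + of_nat (d * j)) m * (norm s ^ m / fact m) * (norm y ^ j / fact j))
        summable_on UNIV"
      using assms by (intro binomial_exp_double_summable) auto
  qed (auto simp: norm_mult norm_divide norm_power simp del: of_nat_mult
      intro!: mult_right_mono divide_right_mono bound)
  then have "(\<lambda>(j, m). ?f (m, j)) summable_on UNIV \<times> UNIV"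
    by (subst summable_on_swap) simp
  moreover have "((\<lambda>m. ?f (m, j)) has_sum (1 - s) powr (- b) * ((y / (1 - s) ^ d) ^ j / fact j)) UNIV" for j
  proof -
    let ?a = "\<lambda>m. pochhammer (b + of_nat (d * j)) m * (s ^ m / fact m)"
    have "summable (\<lambda>m. norm (?a m))"
    proof (rule summable_comparison_test')
      show "summable (\<lambda>m. pochhammer (norm b + of_nat (d * j)) m * (norm s ^ m / fact m))"
        using pochhammer_sums_real[of "norm s"] assms by (auto simp: sums_iff)
    qed (auto simp: norm_mult norm_divide norm_power simp del: of_nat_mult
        intro!: mult_right_mono divide_right_mono bound)
    then have "(?a has_sum (1 - s) powr (- (b + of_nat (d * j)))) UNIV"
      using pochhammer_sums_complex[OF assms] by (rule norm_summable_imp_has_sum)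
    then have "((\<lambda>m. ?a m * (y ^ j / fact j)) has_sum
        (1 - s) powr (- (b + of_nat (d * j))) * (y ^ j / fact j)) UNIV"
      by (rule has_sum_cmult_left)
    moreover have "1 - s \<noteq> 0"
      using assms by auto
    then have "(1 - s) powr (- (b + of_nat (d * j))) = (1 - s) powr (- b) / ((1 - s) ^ d) ^ j"
      unfolding minus_add_distrib add_uminus_conv_diff powr_diff
      by (simp only: powr_nat power_mult if_False)
    ultimately show ?thesis
      by (simp add: power_divide)
  qed
  moreover have "((\<lambda>j. (1 - s) powr (- b) * ((y / (1 - s) ^ d) ^ j / fact j))
      has_sum (1 - s) powr (- b) * exp (y / (1 - s) ^ d)) UNIV"
  proof (rule has_sum_cmult_right, rule norm_summable_imp_has_sum)
    show "summable (\<lambda>j. norm ((y / (1 - s) ^ d) ^ j / fact j))"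
      using summable_norm_exp[of "y / (1 - s) ^ d"] by (simp add: scaleR_conv_of_real field_simps norm_divide norm_mult)
    show "(\<lambda>j. (y / (1 - s) ^ d) ^ j / fact j) sums exp (y / (1 - s) ^ d)"
      using exp_converges[of "y / (1 - s) ^ d"] by (simp add: scaleR_conv_of_real field_simps)
  qed
  ultimately have "((\<lambda>(j, m). ?f (m, j)) has_sum (1 - s) powr (- b) * exp (y / (1 - s) ^ d)) (UNIV \<times> UNIV)"
    by (intro has_sum_SigmaI) auto
  then show ?thesis
    by (subst (asm) has_sum_swap) simp
qed

text \<open>
  The quotient of consecutive terms is \<open>(a + n) / (c + n)\<close> and tends to 1, so that after division by
  \<open>r\<^sup>n\<close> the norms are eventually non-increasing.
\<close>

lemma pochhammer_ratio_bound:
  fixes a c :: complex and r :: real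
  assumes c: "c \<notin> \<int>\<^sub>\<le>\<^sub>0" and r: "r > 1"
  obtains C where "\<And>n. norm (pochhammer a n / pochhammer c n) \<le> C * r ^ n"
proof -
  define f where "f n = pochhammer a n / pochhammer c n / of_real r ^ n" for n
  have "(\<lambda>n. (a + of_nat n) / (c + of_nat n)) \<longlonglongrightarrow> 1"
  proof -
    have lim: "(\<lambda>n. b / of_nat n) \<longlonglongrightarrow> 0" for b :: complex
      by (rule lim_const_over_n)
    have "(\<lambda>n. (a / of_nat n + 1) / (c / of_nat n + 1)) \<longlonglongrightarrow> (0 + 1) / (0 + 1)"
      by (intro tendsto_intros lim) auto
    then have "(\<lambda>n. (a / of_nat n + 1) / (c / of_nat n + 1)) \<longlonglongrightarrow> 1"
      by simp
    moreover have "eventually (\<lambda>n. (a / of_nat n + 1) / (c / of_nat n + 1) = (a + of_nat n) / (c + of_nat n)) sequentially"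
      using eventually_gt_at_top[of 0] by eventually_elim (simp add: divide_simps)
    ultimately show ?thesis
      by (rule Lim_transform_eventually)
  qed
  then have "(\<lambda>n. norm ((a + of_nat n) / (c + of_nat n))) \<longlonglongrightarrow> 1"
    using tendsto_norm by fastforce
  then have "eventually (\<lambda>n. norm ((a + of_nat n) / (c + of_nat n)) < r) sequentially"
    using r by (rule order_tendstoD)
  then obtain N where N: "\<And>n. n \<ge> N \<Longrightarrow> norm ((a + of_nat n) / (c + of_nat n)) < r"
    by (auto simp: eventually_at_top_linorder)
  have step: "norm (f (Suc n)) \<le> norm (f n)" if "n \<ge> N" for n
  proof -
    have "f (Suc n) = f n * ((a + of_nat n) / (c + of_nat n) / of_real r)"
      by (simp add: f_def pochhammer_Suc)
    also have "norm \<dots> = norm (f n) * (norm ((a + of_nat n) / (c + of_nat n)) / r)"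
      using r by (simp add: norm_mult norm_divide)
    also have "\<dots> \<le> norm (f n) * 1"
      using N[OF that] r by (intro mult_left_mono) auto
    finally show ?thesis
      by simp
  qed
  have late: "norm (f n) \<le> norm (f N)" if "n \<ge> N" for n
    using that by (induction n rule: dec_induct) (use step in \<open>auto intro: order_trans\<close>)
  have bound: "norm (f n) \<le> (\<Sum>k\<le>N. norm (f k))" for n
  proof (cases "n \<le> N")
    case True
    then show ?thesis
      by (intro member_le_sum) auto
  next
    case False
    then have "norm (f n) \<le> norm (f N)"
      using late by simp
    also have "\<dots> \<le> (\<Sum>k\<le>N. norm (f k))"
      by (intro member_le_sum) auto
    finally show ?thesis .
  qed
  show ?thesis
  proof
    fix n
    have "norm (pochhammer a n / pochhammer c n) = norm (f n) * r ^ n"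
      using r by (simp add: f_def norm_divide norm_mult norm_power)
    also have "\<dots> \<le> (\<Sum>k\<le>N. norm (f k)) * r ^ n"
      using bound r by (intro mult_right_mono) auto
    finally show "norm (pochhammer a n / pochhammer c n) \<le> (\<Sum>k\<le>N. norm (f k)) * r ^ n" .
  qed
qed

section \<open>The explicit form of the Laguerre polynomials\<close>

definition laguerre_coeff :: "complex \<Rightarrow> complex ^ 'k \<Rightarrow> nat ^ 'k \<Rightarrow> complex"
  where "laguerre_coeff a x n = (\<Sum>(p, q) | p + q = n.
    pochhammer (a + 1 + of_nat \<langle>q\<rangle>) \<langle>p\<rangle> * exp_monomial 1 p * exp_monomial (- x) q)"

lemma vtotal_norm_le: "norm \<langle>z\<rangle> \<le> (\<Sum>i\<in>UNIV. norm (z $ i))"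
  for z :: "'a::real_normed_vector ^ 'k"
  unfolding vtotal_def by (rule norm_sum)

lemma laguerre_generating_function:
  fixes x z :: "complex ^ 'k"
  assumes z: "(\<Sum>i\<in>UNIV. cmod (z $ i)) < 1"
  shows "((\<lambda>n. laguerre_coeff a x n * mpow z n) has_sum
    (1 - \<langle>z\<rangle>) powr (- a - 1) * exp (- (\<langle>x * z\<rangle> / (1 - \<langle>z\<rangle>)))) UNIV"
proof -
  let ?S = "\<Sum>i\<in>UNIV. cmod (z $ i)" and ?Y = "\<Sum>i\<in>UNIV. cmod ((- x * z) $ i)"
  have "(\<lambda>(m, j). norm (pochhammer (a + 1 + of_nat j) m) * (?S ^ m / fact m) * (?Y ^ j / fact j))
      summable_on UNIV"
  proof (rule summable_on_comparison_test)
    show "(\<lambda>(m, j). pochhammer (norm (a + 1) + of_nat (1 * j)) m * (?S ^ m / fact m) * (?Y ^ j / fact j))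
        summable_on UNIV"
      using z by (intro binomial_exp_double_summable) (auto intro: sum_nonneg)
    have "norm (pochhammer (a + 1 + of_nat j) m) \<le> pochhammer (norm (a + 1) + of_nat (1 * j)) m" for j m
      using norm_triangle_ineq[of "a + 1" "of_nat j"] by (intro norm_pochhammer_le) simp
    then show "(case mj of (m, j) \<Rightarrow> norm (pochhammer (a + 1 + of_nat j) m) * (?S ^ m / fact m) * (?Y ^ j / fact j))
        \<le> (case mj of (m, j) \<Rightarrow> pochhammer (norm (a + 1) + of_nat (1 * j)) m * (?S ^ m / fact m) * (?Y ^ j / fact j))"
      for mj
      by (cases mj) (simp only: prod.case, intro mult_right_mono, auto intro!: divide_nonneg_nonneg zero_le_power sum_nonneg)
    show "0 \<le> (case mj of (m, j) \<Rightarrow> norm (pochhammer (a + 1 + of_nat j) m) * (?S ^ m / fact m) * (?Y ^ j / fact j))"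
      for mj
      by (cases mj) (auto intro!: mult_nonneg_nonneg divide_nonneg_nonneg zero_le_power sum_nonneg)
  qed
  moreover have "((\<lambda>(m, j). pochhammer (a + 1 + of_nat j) m * (\<langle>z\<rangle> ^ m / fact m) * (\<langle>- x * z\<rangle> ^ j / fact j))
      has_sum (1 - \<langle>z\<rangle>) powr (- (a + 1)) * exp (\<langle>- x * z\<rangle> / (1 - \<langle>z\<rangle>))) UNIV"
    using binomial_exp_double_has_sum[of "\<langle>z\<rangle>" "a + 1" 1 "\<langle>- x * z\<rangle>"] vtotal_norm_le[of z] z by simp
  ultimately have "((\<lambda>n. \<Sum>(p, q) | p + q = n. pochhammer (a + 1 + of_nat \<langle>q\<rangle>) \<langle>p\<rangle>
      * exp_monomial z p * exp_monomial (- x * z) q)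
      has_sum (1 - \<langle>z\<rangle>) powr (- (a + 1)) * exp (\<langle>- x * z\<rangle> / (1 - \<langle>z\<rangle>))) UNIV"
    by (rule double_series_expansion)
  also have "(\<lambda>n. \<Sum>(p, q) | p + q = n. pochhammer (a + 1 + of_nat \<langle>q\<rangle>) \<langle>p\<rangle>
      * exp_monomial z p * exp_monomial (- x * z) q) = (\<lambda>n. laguerre_coeff a x n * mpow z n)"
    unfolding laguerre_coeff_def sum_distrib_right
  proof (intro ext sum.cong refl, clarify)
    fix p q :: "nat ^ 'k"
    have z_p: "exp_monomial z p = exp_monomial 1 p * mpow z p"
      using exp_monomial_mult[of 1 z p] by simp
    show "pochhammer (a + 1 + of_nat \<langle>q\<rangle>) \<langle>p\<rangle> * exp_monomial z p * exp_monomial (- x * z) q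
      = pochhammer (a + 1 + of_nat \<langle>q\<rangle>) \<langle>p\<rangle> * exp_monomial 1 p * exp_monomial (- x) q * mpow z (p + q)"
      unfolding z_p exp_monomial_mult mpow_add by (simp only: mult_ac)
  qed
  also have "\<langle>- x * z\<rangle> = - \<langle>x * z\<rangle>"
    by (simp add: vtotal_def sum_negf)
  finally show ?thesis
    by simp
qed

lemma mlaguerre_eq: "mlaguerre a x = laguerre_coeff a x"
  unfolding mlaguerre_def
proof (rule the_equality)
  show "\<forall>z. (\<Sum>i\<in>UNIV. cmod (z $ i)) < 1 \<longrightarrow> ((\<lambda>n. laguerre_coeff a x n * mpow z n) has_sum
      (1 - \<langle>z\<rangle>) powr (- a - 1) * exp (- (\<langle>x * z\<rangle> / (1 - \<langle>z\<rangle>)))) UNIV"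
    using laguerre_generating_function by blast
next
  fix c :: "nat ^ 'a \<Rightarrow> complex"
  assume c: "\<forall>z. (\<Sum>i\<in>UNIV. cmod (z $ i)) < 1 \<longrightarrow> ((\<lambda>n. c n * mpow z n) has_sum
      (1 - \<langle>z\<rangle>) powr (- a - 1) * exp (- (\<langle>x * z\<rangle> / (1 - \<langle>z\<rangle>)))) UNIV"
  have "c n - laguerre_coeff a x n = 0" for n
  proof (rule power_series_identity)
    fix z :: "complex ^ 'a"
    assume z: "(\<Sum>i\<in>UNIV. cmod (z $ i)) < 1"
    show "((\<lambda>n. (c n - laguerre_coeff a x n) * mpow z n) has_sum 0) UNIV"
      using has_sum_add[OF c[rule_format, OF z]
          has_sum_uminusI[OF laguerre_generating_function[OF z, of a x]]]
      by (simp add: left_diff_distrib)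
  qed
  then show "c = laguerre_coeff a x"
    by (simp add: fun_eq_iff)
qed

text \<open>
  For \<open>n = p + q\<close> the parameter cancels \<open>\<langle>q\<rangle>\<close>, and reversing the factors of the Pochhammer symbol
  \<open>(1 - b - \<langle>p\<rangle>)\<^sub>\<langle>\<^sub>p\<^sub>\<rangle>\<close> leaves \<open>(b)\<^sub>\<langle>\<^sub>p\<^sub>\<rangle>\<close> and a sign, which turns \<open>u\<close> into \<open>- u\<close>. The summand becomes the
  term \<open>(p, q)\<close> of a double series whose coefficients do not depend on \<open>n\<close>.
\<close>

lemma laguerre_lowered_parameter_mult_mpow:
  fixes u x :: "complex ^ 'k"
  shows "mlaguerre (- b - of_nat \<langle>n\<rangle>) x n * mpow u n
    = (\<Sum>(p, q) | p + q = n. pochhammer b \<langle>p\<rangle> * exp_monomial (- u) p * exp_monomial (- (u * x)) q)"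
  unfolding mlaguerre_eq laguerre_coeff_def sum_distrib_right
proof (intro sum.cong refl, clarify)
  fix p q :: "nat ^ 'k"
  have "pochhammer (- b - of_nat \<langle>p + q\<rangle> + 1 + of_nat \<langle>q\<rangle>) \<langle>p\<rangle> = pochhammer (- b - of_nat \<langle>p\<rangle> + 1) \<langle>p\<rangle>"
    by (simp add: vtotal_add algebra_simps)
  also have "\<dots> = (- 1) ^ \<langle>p\<rangle> * pochhammer b \<langle>p\<rangle>"
    by (simp add: pochhammer_minus')
  finally have poch: "pochhammer (- b - of_nat \<langle>p + q\<rangle> + 1 + of_nat \<langle>q\<rangle>) \<langle>p\<rangle> = (- 1) ^ \<langle>p\<rangle> * pochhammer b \<langle>p\<rangle>" .
  have u: "exp_monomial (- u) p = (- 1) ^ \<langle>p\<rangle> * exp_monomial 1 p * mpow u p"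
    using exp_monomial_mult[of 1 u p] by (simp add: exp_monomial_uminus)
  have "- (u * x) = - x * u"
    by (simp add: vec_eq_iff)
  then have ux: "exp_monomial (- (u * x)) q = exp_monomial (- x) q * mpow u q"
    by (simp only: exp_monomial_mult)
  show "pochhammer (- b - of_nat \<langle>p + q\<rangle> + 1 + of_nat \<langle>q\<rangle>) \<langle>p\<rangle> * exp_monomial 1 p * exp_monomial (- x) q * mpow u (p + q)
      = pochhammer b \<langle>p\<rangle> * exp_monomial (- u) p * exp_monomial (- (u * x)) q"
    unfolding poch u ux mpow_add by (simp only: mult_ac)
qed

section \<open>Humbert's function\<close>

text \<open>
  Bounding \<open>(a)\<^sub>n / (c)\<^sub>n\<close> by \<open>C * r\<^sup>n\<close> rescales both variables by \<open>r\<close>, which is harmless as long as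
  \<open>r * S < 1\<close>. What remains is a binomial series times an exponential series.
\<close>

lemma humbert_Phi1_abs_summable:
  fixes a b c :: complex and S Y :: real
  assumes c: "c \<notin> \<int>\<^sub>\<le>\<^sub>0" and S: "0 \<le> S" "S < 1" and Y: "0 \<le> Y"
  shows "(\<lambda>(m, j). norm (pochhammer a (m + j) * pochhammer b m / pochhammer c (m + j))
    * (S ^ m / fact m) * (Y ^ j / fact j)) summable_on UNIV"
proof -
  \<comment> \<open>A number between \<open>1\<close> and \<open>1 / S\<close> that needs no case distinction for \<open>S = 0\<close>.\<close>
  define r where "r = 2 / (1 + S)"
  have r: "r > 1" "r * S < 1"
    using S by (auto simp: r_def field_simps)
  obtain C where C: "\<And>n. norm (pochhammer a n / pochhammer c n) \<le> C * r ^ n"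
    using pochhammer_ratio_bound[OF c r(1), of a] by blast
  show ?thesis
  proof (rule summable_on_comparison_test)
    show "(\<lambda>mj. C * (case mj of (m, j) \<Rightarrow> pochhammer (norm b + of_nat (0 * j)) m
        * ((r * S) ^ m / fact m) * ((r * Y) ^ j / fact j))) summable_on UNIV"
      using r S Y by (intro summable_on_cmult_right binomial_exp_double_summable) auto
  next
    fix mj :: "nat \<times> nat"
    obtain m j where mj: "mj = (m, j)"
      by fastforce
    have "norm (pochhammer a (m + j) / pochhammer c (m + j)) * norm (pochhammer b m)
        \<le> C * r ^ (m + j) * pochhammer (norm b) m"
      using order_trans[OF norm_ge_zero C] by (intro mult_mono C norm_pochhammer_le) auto
    then have "norm (pochhammer a (m + j) / pochhammer c (m + j)) * norm (pochhammer b m)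
          * ((S ^ m / fact m) * (Y ^ j / fact j))
        \<le> C * r ^ (m + j) * pochhammer (norm b) m * ((S ^ m / fact m) * (Y ^ j / fact j))"
      using S Y by (intro mult_right_mono) auto
    then show "(case mj of (m, j) \<Rightarrow> norm (pochhammer a (m + j) * pochhammer b m / pochhammer c (m + j))
        * (S ^ m / fact m) * (Y ^ j / fact j))
        \<le> C * (case mj of (m, j) \<Rightarrow> pochhammer (norm b + of_nat (0 * j)) m
        * ((r * S) ^ m / fact m) * ((r * Y) ^ j / fact j))"
      by (simp add: mj norm_mult norm_divide power_mult_distrib power_add mult_ac)
    show "0 \<le> (case mj of (m, j) \<Rightarrow> norm (pochhammer a (m + j) * pochhammer b m / pochhammer c (m + j))
        * (S ^ m / fact m) * (Y ^ j / fact j))"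
      using S Y by (simp add: mj)
  qed
qed

text \<open>
  The first claim takes for \<open>S\<close> in \<open>expansion\<close> the sum that defines \<open>\<Phi>\<^sub>1\<close>; the second takes the closed
  form of the double series at \<open>a = \<gamma>\<close>, where the quotient of Pochhammer symbols is 1.
\<close>

theorem proposition2p1:
  fixes \<alpha> \<beta> \<gamma> :: complex and u x :: "complex ^ 'k"
  assumes "- \<beta> \<notin> \<int>\<^sub>\<le>\<^sub>0" and "\<gamma> \<notin> \<int>\<^sub>\<le>\<^sub>0"
    and "(\<Sum>i\<in>UNIV. cmod (u $ i)) < 1"
  shows "((\<lambda>n :: nat ^ 'k. pochhammer \<alpha> \<langle>n\<rangle> / pochhammer \<gamma> \<langle>n\<rangle>
            * mlaguerre (- \<beta> - of_nat \<langle>n\<rangle>) x n * mpow u n)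
          has_sum humbert_Phi1 \<alpha> \<beta> \<gamma> (- \<langle>u\<rangle>) (- \<langle>u * x\<rangle>)) UNIV
    \<and> (\<alpha> = \<gamma> \<longrightarrow>
        ((\<lambda>n :: nat ^ 'k. mlaguerre (- \<beta> - of_nat \<langle>n\<rangle>) x n * mpow u n)
          has_sum exp (- \<langle>u * x\<rangle>) * (1 + \<langle>u\<rangle>) powr (- \<beta>)) UNIV)"
proof -
  define c where "c a m j = pochhammer a (m + j) * pochhammer \<beta> m / pochhammer \<gamma> (m + j)" for a m j
  let ?\<Phi> = "\<lambda>a (m, j). c a m j * (\<langle>- u\<rangle> ^ m / fact m) * (\<langle>- (u * x)\<rangle> ^ j / fact j)"
  have abs: "(\<lambda>(m, j). norm (c a m j) * ((\<Sum>i\<in>UNIV. cmod ((- u) $ i)) ^ m / fact m)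
      * ((\<Sum>i\<in>UNIV. cmod ((- (u * x)) $ i)) ^ j / fact j)) summable_on UNIV" for a
    unfolding c_def using assms(2,3) by (intro humbert_Phi1_abs_summable) (auto intro: sum_nonneg)
  have expansion: "((\<lambda>n. pochhammer a \<langle>n\<rangle> / pochhammer \<gamma> \<langle>n\<rangle> * mlaguerre (- \<beta> - of_nat \<langle>n\<rangle>) x n * mpow u n)
      has_sum S) UNIV" if "(?\<Phi> a has_sum S) UNIV" for a S
  proof -
    have "((\<lambda>n. \<Sum>(p, q) | p + q = n. c a \<langle>p\<rangle> \<langle>q\<rangle> * exp_monomial (- u) p * exp_monomial (- (u * x)) q)
        has_sum S) UNIV"
      using abs that by (rule double_series_expansion)
    also have "(\<lambda>n. \<Sum>(p, q) | p + q = n. c a \<langle>p\<rangle> \<langle>q\<rangle> * exp_monomial (- u) p * exp_monomial (- (u * x)) q)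
        = (\<lambda>n. pochhammer a \<langle>n\<rangle> / pochhammer \<gamma> \<langle>n\<rangle> * (mlaguerre (- \<beta> - of_nat \<langle>n\<rangle>) x n * mpow u n))"
      unfolding laguerre_lowered_parameter_mult_mpow sum_distrib_left
      by (intro ext sum.cong refl) (auto simp: c_def vtotal_add)
    finally show ?thesis
      by (simp only: mult.assoc)
  qed
  have "?\<Phi> \<alpha> summable_on UNIV"
  proof (rule abs_summable_summable, rule Infinite_Sum.abs_summable_on_comparison_test'[OF abs])
    fix mj :: "nat \<times> nat"
    obtain m j where mj: "mj = (m, j)"
      by fastforce
    have "norm (?\<Phi> \<alpha> mj) = norm (c \<alpha> m j) * (norm \<langle>- u\<rangle> ^ m / fact m) * (norm \<langle>- (u * x)\<rangle> ^ j / fact j)"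
      by (simp add: mj norm_mult norm_divide norm_power)
    also have "\<dots> \<le> norm (c \<alpha> m j) * ((\<Sum>i\<in>UNIV. cmod ((- u) $ i)) ^ m / fact m)
        * ((\<Sum>i\<in>UNIV. cmod ((- (u * x)) $ i)) ^ j / fact j)"
      by (intro mult_mono mult_nonneg_nonneg divide_right_mono power_mono vtotal_norm_le)
        (auto intro!: divide_nonneg_nonneg zero_le_power sum_nonneg)
    finally show "norm (?\<Phi> \<alpha> mj) \<le> (case mj of (m, j) \<Rightarrow> norm (c \<alpha> m j)
        * ((\<Sum>i\<in>UNIV. cmod ((- u) $ i)) ^ m / fact m)
        * ((\<Sum>i\<in>UNIV. cmod ((- (u * x)) $ i)) ^ j / fact j))"
      by (simp add: mj)
  qed
  then have "(?\<Phi> \<alpha> has_sum infsum (?\<Phi> \<alpha>) UNIV) UNIV"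
    by (rule has_sum_infsum)
  also have "infsum (?\<Phi> \<alpha>) UNIV = humbert_Phi1 \<alpha> \<beta> \<gamma> (- \<langle>u\<rangle>) (- \<langle>u * x\<rangle>)"
    by (simp add: humbert_Phi1_def c_def vtotal_uminus)
  finally have "((\<lambda>n. pochhammer \<alpha> \<langle>n\<rangle> / pochhammer \<gamma> \<langle>n\<rangle> * mlaguerre (- \<beta> - of_nat \<langle>n\<rangle>) x n * mpow u n)
      has_sum humbert_Phi1 \<alpha> \<beta> \<gamma> (- \<langle>u\<rangle>) (- \<langle>u * x\<rangle>)) UNIV"
    by (rule expansion)
  moreover have "((\<lambda>n. mlaguerre (- \<beta> - of_nat \<langle>n\<rangle>) x n * mpow u n)
      has_sum exp (- \<langle>u * x\<rangle>) * (1 + \<langle>u\<rangle>) powr (- \<beta>)) UNIV"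
  proof -
    have nz: "pochhammer \<gamma> n \<noteq> 0" for n
      using assms(2) pochhammer_eq_0_imp_nonpos_Int by blast
    have "norm \<langle>- u\<rangle> < 1"
      using assms(3) vtotal_norm_le[of u] by (simp add: vtotal_uminus)
    from binomial_exp_double_has_sum[OF this, of \<beta> 0 "\<langle>- (u * x)\<rangle>"]
    have "(?\<Phi> \<gamma> has_sum exp (- \<langle>u * x\<rangle>) * (1 + \<langle>u\<rangle>) powr (- \<beta>)) UNIV"
      by (simp add: c_def nz vtotal_uminus mult.commute[of "exp _"])
    from expansion[OF this] show ?thesis
      by (simp add: nz)
  qed
  ultimately show ?thesis
    by blast
qed

end
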